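(* Let $\mathfrak{M}$ be the set of all closed intervals $[a,b]\subseteq\mathbb{R}$ with $|a-b|<1$ and let $I$ be the open interval $(0,1)\subseteq\mathbb{R}$ (all with the metric induced from $\mathbb{R}$). Then $I$ is a minimal $\mathfrak{M}$-universal metric space. Moreover, if $X$ is an arbitrary minimal $\mathfrak{M}$-universal metric space, then $X\simeq I$.
   Context: For metric spaces $X,Y$, write $X\hookrightarrow Y$ if there is an isometric embedding (distance-preserving map) of $X$ in $Y$, and $X\simeq Y$ if $X$ and $Y$ are isometric. Subsets of metric spaces carry the induced metric. A metric space $Y$ is universal for a class $\mathfrak{M}$ of metric spaces ($\mathfrak{M}$-universal, written $\mathfrak{M}\hookrightarrow Y$) if $Z\hookrightarrow Y$ for every $Z\in\mathfrak{M}$; it is minimal $\mathfrak{M}$-universal if moreover for every subspace $Y_0\subseteq Y$, $\mathfrak{M}\hookrightarrow Y_0$ implies $Y_0=Y$. *)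

theory Defs
  imports "HOL-Analysis.Analysis"
begin

definition isometric_embedding :: "('a \<Rightarrow> 'b) \<Rightarrow> 'a metric \<Rightarrow> 'b metric \<Rightarrow> bool" where
  "isometric_embedding f X Y \<longleftrightarrow>
     f ` mspace X \<subseteq> mspace Y \<and>
     (\<forall>x\<in>mspace X. \<forall>y\<in>mspace X. mdist Y (f x) (f y) = mdist X x y)"

definition embeds_isometrically :: "'a metric \<Rightarrow> 'b metric \<Rightarrow> bool" where
  "embeds_isometrically X Y \<longleftrightarrow> (\<exists>f. isometric_embedding f X Y)"

definition isometric :: "'a metric \<Rightarrow> 'b metric \<Rightarrow> bool" where
  "isometric X Y \<longleftrightarrow> (\<exists>f. isometric_embedding f X Y \<and> f ` mspace X = mspace Y)"

definition universal_for :: "'a metric set \<Rightarrow> 'b metric \<Rightarrow> bool" where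
  "universal_for \<MM> Y \<longleftrightarrow> (\<forall>Z\<in>\<MM>. embeds_isometrically Z Y)"

definition minimal_universal_for :: "'a metric set \<Rightarrow> 'b metric \<Rightarrow> bool" where
  "minimal_universal_for \<MM> Y \<longleftrightarrow>
     universal_for \<MM> Y \<and>
     (\<forall>Y0 \<subseteq> mspace Y. universal_for \<MM> (submetric Y Y0) \<longrightarrow> Y0 = mspace Y)"

(* Singletons {a..a} are included; the condition a \<le> b only excludes the empty set, which is
   what {a..b} denotes for a > b. *)
definition short_closed_intervals :: "real metric set" where
  "short_closed_intervals =
     {submetric euclidean_metric {a..b} | a b :: real. a \<le> b \<and> \<bar>a - b\<bar> < 1}"

definition open_unit_interval :: "real metric" where
  "open_unit_interval = submetric euclidean_metric {0<..<1}"

end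

theory Submission
  imports Defs
begin

text \<open>
  An isometric copy of \<open>[0, l]\<close> in the real line is again a closed interval of length \<open>l\<close>. A copy
  inside \<open>(0, 1)\<close> therefore covers \<open>[1 - l, l]\<close>, and letting \<open>l\<close> tend to \<open>1\<close> these cover \<open>(0, 1)\<close>:
  a universal subspace of \<open>(0, 1)\<close> is everything.

  For uniqueness, let \<open>X\<close> be minimal universal and \<open>x\<close> a point of it. By minimality some \<open>[0, r]\<close> with
  \<open>r < 1\<close> does not embed in \<open>X - {x}\<close>, so every copy in \<open>X\<close> of every \<open>[0, l]\<close> with \<open>l \<ge> r\<close> passes
  through \<open>x\<close> (\<open>minimal_universal_point_in_long_segments\<close>). Taking the largest such \<open>r\<close>, any finite set
  of points of \<open>X\<close> lies on one segment of length less than \<open>1\<close>. Since a space embeds in the line as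
  soon as its quadruples do (\<open>embeds_in_line_if_quadruples_do\<close>), \<open>X\<close> is isometric to a set \<open>S\<close> of
  reals. Any two points of \<open>S\<close> lie in a closed subinterval of \<open>S\<close> of length less than \<open>1\<close>, and such
  subintervals occur with length arbitrarily close to \<open>1\<close>. Hence \<open>S\<close> contains an open interval of
  length \<open>1\<close>. That interval is already universal, so by minimality it is all of \<open>S\<close>.
\<close>

section \<open>Isometric embeddings of segments\<close>

abbreviation segment :: "real \<Rightarrow> real metric" where
  "segment l \<equiv> submetric euclidean_metric {0..l}"

lemma isometric_embedding_segment_iff:
  "isometric_embedding f (segment l) Y \<longleftrightarrow>
     (\<forall>s\<in>{0..l}. f s \<in> mspace Y) \<and>
     (\<forall>s\<in>{0..l}. \<forall>t\<in>{0..l}. mdist Y (f s) (f t) = \<bar>s - t\<bar>)"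
  by (auto simp: isometric_embedding_def image_subset_iff dist_real_def)

lemma isometric_embedding_compose:
  assumes "isometric_embedding f X Y" "isometric_embedding g Y Z"
  shows "isometric_embedding (g \<circ> f) X Z"
  using assms by (auto simp: isometric_embedding_def image_subset_iff)

lemma segment_embedding_shorten:
  assumes "isometric_embedding f (segment l) Y" "r \<le> l"
  shows "isometric_embedding f (segment r) Y"
  using assms by (auto simp: isometric_embedding_segment_iff)

lemma universal_iff_segments_embed:
  "universal_for short_closed_intervals Y \<longleftrightarrow>
     (\<forall>l. 0 \<le> l \<and> l < 1 \<longrightarrow> embeds_isometrically (segment l) Y)"
proof
  assume "universal_for short_closed_intervals Y"
  then show "\<forall>l. 0 \<le> l \<and> l < 1 \<longrightarrow> embeds_isometrically (segment l) Y"
    by (force simp: universal_for_def short_closed_intervals_def)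
next
  assume *: "\<forall>l. 0 \<le> l \<and> l < 1 \<longrightarrow> embeds_isometrically (segment l) Y"
  have "embeds_isometrically (submetric euclidean_metric {a..b}) Y"
    if ab: "a \<le> b" "\<bar>a - b\<bar> < 1" for a b :: real
  proof -
    obtain f where f: "isometric_embedding f (segment (b - a)) Y"
      using *[rule_format, of "b - a"] ab by (auto simp: embeds_isometrically_def)
    have "isometric_embedding (\<lambda>x. x - a) (submetric euclidean_metric {a..b}) (segment (b - a))"
      by (auto simp: isometric_embedding_def dist_real_def)
    from isometric_embedding_compose[OF this f] show ?thesis
      by (auto simp: embeds_isometrically_def)
  qed
  then show "universal_for short_closed_intervals Y"
    by (auto simp: universal_for_def short_closed_intervals_def)
qed

section \<open>Segments in the real line\<close>

lemma segment_image_in_line: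
  fixes f :: "real \<Rightarrow> real"
  assumes f: "isometric_embedding f (segment l) euclidean_metric" and "0 \<le> l"
  obtains c where "f ` {0..l} = {c..c + l}"
proof
  have d: "\<bar>f s - f t\<bar> = \<bar>s - t\<bar>" if "s \<in> {0..l}" "t \<in> {0..l}" for s t
    using f that by (auto simp: isometric_embedding_segment_iff dist_real_def)
  have ends: "\<bar>f 0 - f l\<bar> = l" using d[of 0 l] \<open>0 \<le> l\<close> by simp
  define c where "c = min (f 0) (f l)"
  have "continuous_on {0..l} f"
    by (rule continuous_onI) (use d in \<open>auto simp: dist_real_def\<close>)
  then have conn: "connected (f ` {0..l})"
    by (intro connected_continuous_image) auto
  have "f 0 \<in> f ` {0..l}" "f l \<in> f ` {0..l}" using \<open>0 \<le> l\<close> by auto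
  then have "c \<in> f ` {0..l}" "c + l \<in> f ` {0..l}"
    using ends unfolding c_def by (smt (verit))+
  then have sup: "{c..c + l} \<subseteq> f ` {0..l}"
    using connected_contains_Icc[OF conn] by blast
  have sub: "f ` {0..l} \<subseteq> {c..c + l}"
  proof
    fix y assume "y \<in> f ` {0..l}"
    then obtain t where t: "t \<in> {0..l}" "y = f t" by auto
    have "\<bar>f t - f 0\<bar> = t" "\<bar>f t - f l\<bar> = l - t"
      using d[of t 0] d[of t l] t by auto
    then show "y \<in> {c..c + l}" using ends t unfolding c_def by auto
  qed
  show "f ` {0..l} = {c..c + l}" using sup sub by blast
qed

lemma unit_open_interval_universal:
  assumes S: "S \<subseteq> mspace Y" and h: "isometric_embedding h Y euclidean_metric"
    and hS: "{a<..<a + 1 :: real} \<subseteq> h ` S"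
  shows "universal_for short_closed_intervals (submetric Y S)"
  unfolding universal_iff_segments_embed
proof (intro allI impI)
  fix l :: real assume l: "0 \<le> l \<and> l < 1"
  \<comment> \<open>Centre the copy of \<open>[0, l]\<close>, so that it avoids both ends of the open interval.\<close>
  define c where "c = a + (1 - l) / 2"
  define f where "f t = inv_into S h (c + t)" for t
  have f: "f t \<in> S \<and> h (f t) = c + t" if "t \<in> {0..l}" for t
  proof -
    have "c + t \<in> {a<..<a + 1}" using that l by (auto simp: c_def field_simps)
    then have "c + t \<in> h ` S" using hS by blast
    then show ?thesis by (simp add: f_def inv_into_into f_inv_into_f)
  qed
  have "mdist Y (f s) (f t) = \<bar>s - t\<bar>" if "s \<in> {0..l}" "t \<in> {0..l}" for s t
  proof -
    have "f s \<in> mspace Y" "f t \<in> mspace Y" using f that S by auto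
    then have "mdist Y (f s) (f t) = dist (h (f s)) (h (f t))"
      using h by (simp add: isometric_embedding_def)
    then show ?thesis using f that by (simp add: dist_real_def)
  qed
  then have "isometric_embedding f (segment l) (submetric Y S)"
    using f S by (auto simp: isometric_embedding_segment_iff)
  then show "embeds_isometrically (segment l) (submetric Y S)"
    by (auto simp: embeds_isometrically_def)
qed

section \<open>Minimality of the open unit interval\<close>

lemma minimal_universal_open_unit_interval:
  "minimal_universal_for short_closed_intervals open_unit_interval"
  unfolding minimal_universal_for_def
proof (intro conjI allI impI)
  show "universal_for short_closed_intervals open_unit_interval"
    unfolding open_unit_interval_def
    by (rule unit_open_interval_universal[where h = "\<lambda>x. x" and a = 0])
      (auto simp: isometric_embedding_def)
next
  fix Y0 assume Y0: "Y0 \<subseteq> mspace open_unit_interval"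
    and univ: "universal_for short_closed_intervals (submetric open_unit_interval Y0)"
  have Y0': "Y0 \<subseteq> {0<..<1}" using Y0 by (simp add: open_unit_interval_def)
  have "x \<in> Y0" if x: "x \<in> {0<..<1}" for x
  proof -
    \<comment> \<open>The least length for which \<open>[1 - l, l]\<close> contains \<open>x\<close>.\<close>
    define l where "l = max x (1 - x)"
    have l: "0 \<le> l" "l < 1" "x \<le> l" "1 - l \<le> x" using x by (auto simp: l_def)
    then obtain f where "isometric_embedding f (segment l) (submetric open_unit_interval Y0)"
      using univ unfolding universal_iff_segments_embed embeds_isometrically_def by blast
    then have f: "isometric_embedding f (segment l) euclidean_metric" "f ` {0..l} \<subseteq> Y0"
      using Y0 by (auto simp: isometric_embedding_def open_unit_interval_def)
    obtain c where c: "f ` {0..l} = {c..c + l}"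
      using segment_image_in_line[OF f(1) l(1)] .
    have "c \<in> {c..c + l}" "c + l \<in> {c..c + l}" using l by auto
    then have "0 < c" "c + l < 1" using c f(2) Y0' by (metis greaterThanLessThan_iff subsetD)+
    then have "x \<in> {c..c + l}" using l by auto
    then show ?thesis using c f(2) by blast
  qed
  then show "Y0 = mspace open_unit_interval"
    using Y0' by (auto simp: open_unit_interval_def)
qed

section \<open>Embedding a space in the line\<close>

text \<open>
  Two distinct points \<open>p\<close>, \<open>q\<close> determine the coordinate on the line: if \<open>p\<close> has coordinate \<open>0\<close> and
  \<open>q\<close> has coordinate \<open>D = d(p, q)\<close>, the squared distances of \<open>x\<close> to both determine the coordinate of
  \<open>x\<close> by the law of cosines. On any line through \<open>p, q, x, y\<close> this formula agrees with the
  position up to translation and reflection, so it preserves the distance of \<open>x\<close> and \<open>y\<close>.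
\<close>

lemma embeds_in_line_if_quadruples_do:
  assumes quad: "\<And>p q x y. {p, q, x, y} \<subseteq> mspace X \<Longrightarrow>
    embeds_isometrically (submetric X {p, q, x, y}) (euclidean_metric :: real metric)"
  shows "embeds_isometrically X (euclidean_metric :: real metric)"
proof (cases "\<exists>p\<in>mspace X. \<exists>q\<in>mspace X. p \<noteq> q")
  case False
  then have "mdist X x y = 0" if "x \<in> mspace X" "y \<in> mspace X" for x y
    using that mdist_zero by metis
  then have "isometric_embedding (\<lambda>_. 0 :: real) X euclidean_metric"
    unfolding isometric_embedding_def by simp
  then show ?thesis by (auto simp: embeds_isometrically_def)
next
  case True
  then obtain p q where pq: "p \<in> mspace X" "q \<in> mspace X" "p \<noteq> q" by blast
  define D where "D = mdist X p q"
  define h where "h x = ((mdist X p x)\<^sup>2 + D\<^sup>2 - (mdist X q x)\<^sup>2) / (2 * D)" for x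
  have "\<bar>h x - h y\<bar> = mdist X x y" if xy: "x \<in> mspace X" "y \<in> mspace X" for x y
  proof -
    have in_X: "{p, q, x, y} \<subseteq> mspace X" using pq xy by auto
    obtain g :: "_ \<Rightarrow> real"
      where g: "isometric_embedding g (submetric X {p, q, x, y}) euclidean_metric"
      using quad[OF in_X] by (auto simp: embeds_isometrically_def)
    have d: "mdist X u v = \<bar>g u - g v\<bar>" if "u \<in> {p, q, x, y}" "v \<in> {p, q, x, y}" for u v
    proof -
      have "mspace (submetric X {p, q, x, y}) = {p, q, x, y}"
        using in_X by (simp add: Int_absorb2)
      then have "dist (g u) (g v) = mdist X u v"
        using g that unfolding isometric_embedding_def by (metis mdist_submetric mdist_euclidean_metric)
      then show ?thesis by (simp add: dist_real_def)
    qed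
    define e where "e = sgn (g p - g q)"
    have D: "D = \<bar>g p - g q\<bar>" using d[of p q] by (simp add: D_def)
    have "D \<noteq> 0" using pq by (simp add: D_def)
    then have e: "g p - g q = e * D" "\<bar>e\<bar> = 1"
      by (auto simp: e_def D sgn_mult_abs abs_sgn_eq)
    have coord: "h u = e * (g p - g u)" if u: "u \<in> {p, q, x, y}" for u
    proof -
      have "(mdist X p u)\<^sup>2 + D\<^sup>2 - (mdist X q u)\<^sup>2
          = (g p - g u)\<^sup>2 + (g p - g q)\<^sup>2 - (g q - g u)\<^sup>2"
        using d[of p u] d[of q u] u by (simp add: D)
      also have "\<dots> = 2 * (g p - g q) * (g p - g u)"
        by (simp add: power2_eq_square algebra_simps)
      also have "\<dots> = (e * (g p - g u)) * (2 * D)"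
        by (simp add: e)
      finally show ?thesis using \<open>D \<noteq> 0\<close> by (simp add: h_def)
    qed
    have "h x - h y = e * (g y - g x)"
      using coord[of x] coord[of y] by (simp add: algebra_simps)
    then show ?thesis using e d[of x y] by (simp add: abs_mult abs_minus_commute)
  qed
  then have "isometric_embedding h X euclidean_metric"
    by (auto simp: isometric_embedding_def dist_real_def)
  then show ?thesis by (auto simp: embeds_isometrically_def)
qed

section \<open>Uniqueness\<close>

text \<open>
  Deleting \<open>x\<close> destroys universality, hence the embeddability of some \<open>[0, r]\<close>; a longer segment
  avoiding \<open>x\<close> would contain a copy of \<open>[0, r]\<close> avoiding \<open>x\<close>.
\<close>

lemma minimal_universal_point_in_long_segments:
  assumes "minimal_universal_for short_closed_intervals X" "x \<in> mspace X"
  shows "\<exists>r<1. \<forall>l f. r \<le> l \<longrightarrow> isometric_embedding f (segment l) X \<longrightarrow> x \<in> f ` {0..l}"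
proof -
  let ?X' = "submetric X (mspace X - {x})"
  have "\<not> universal_for short_closed_intervals ?X'"
    using assms unfolding minimal_universal_for_def by blast
  then obtain r where r: "r < 1" "\<not> embeds_isometrically (segment r) ?X'"
    by (auto simp: universal_iff_segments_embed)
  have "x \<in> f ` {0..l}" if l: "r \<le> l" and f: "isometric_embedding f (segment l) X" for l f
  proof (rule ccontr)
    assume "x \<notin> f ` {0..l}"
    then have "isometric_embedding f (segment l) ?X'"
      using f by (auto simp: isometric_embedding_segment_iff)
    then show False
      using segment_embedding_shorten[OF _ l] r(2) by (auto simp: embeds_isometrically_def)
  qed
  then show ?thesis using r(1) by blast
qed

lemma minimal_universal_finite_subset_in_segment:
  assumes min: "minimal_universal_for short_closed_intervals X"
    and F: "finite F" "F \<subseteq> mspace X"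
  obtains l f where "0 \<le> l" "l < 1" "isometric_embedding f (segment l) X" "F \<subseteq> f ` {0..l}"
proof -
  obtain r where r: "\<And>x. x \<in> mspace X \<Longrightarrow> r x < 1"
    "\<And>x l f. x \<in> mspace X \<Longrightarrow> r x \<le> l \<Longrightarrow> isometric_embedding f (segment l) X \<Longrightarrow> x \<in> f ` {0..l}"
    using minimal_universal_point_in_long_segments[OF min] by metis
  define l where "l = Max (insert 0 (r ` F))"
  have l: "0 \<le> l" "l < 1" "\<And>x. x \<in> F \<Longrightarrow> r x \<le> l"
    using F r(1) by (auto simp: l_def)
  then obtain f where f: "isometric_embedding f (segment l) X"
    using min unfolding minimal_universal_for_def universal_iff_segments_embed
      embeds_isometrically_def by blast
  have "F \<subseteq> f ` {0..l}" using r(2)[OF _ l(3) f] F(2) by blast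
  then show ?thesis using that l f by blast
qed

lemma minimal_universal_embeds_in_line:
  assumes min: "minimal_universal_for short_closed_intervals X"
  shows "embeds_isometrically X (euclidean_metric :: real metric)"
proof (rule embeds_in_line_if_quadruples_do)
  fix p q x y assume F: "{p, q, x, y} \<subseteq> mspace X"
  obtain l f where f: "isometric_embedding f (segment l) X" "{p, q, x, y} \<subseteq> f ` {0..l}"
    using minimal_universal_finite_subset_in_segment[OF min _ F] by blast
  define g where "g = inv_into {0..l} f"
  have g: "g u \<in> {0..l}" "f (g u) = u" if "u \<in> {p, q, x, y}" for u
  proof -
    have "u \<in> f ` {0..l}" using f(2) that by blast
    then show "g u \<in> {0..l}" "f (g u) = u"
      unfolding g_def by (rule inv_into_into, rule f_inv_into_f)
  qed
  have "dist (g u) (g v) = mdist X u v" if "u \<in> {p, q, x, y}" "v \<in> {p, q, x, y}" for u v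
    using f(1) g[OF that(1)] g[OF that(2)]
    unfolding isometric_embedding_segment_iff dist_real_def by metis
  then have "isometric_embedding g (submetric X {p, q, x, y}) euclidean_metric"
    unfolding isometric_embedding_def by simp
  then show "embeds_isometrically (submetric X {p, q, x, y}) (euclidean_metric :: real metric)"
    by (auto simp: embeds_isometrically_def)
qed

text \<open>
  The interval starts at \<open>Inf S\<close>, which exists because two points of \<open>S\<close> are less than \<open>1\<close> apart.
  A subinterval of length \<open>l\<close> ends at \<open>Inf S + l\<close> or later, while \<open>S\<close> has points arbitrarily close to
  \<open>Inf S\<close>; everything between such a point and that end lies in \<open>S\<close>.
\<close>

lemma contains_open_unit_interval:
  fixes S :: "real set"
  assumes pairs: "\<And>x y. x \<in> S \<Longrightarrow> y \<in> S \<Longrightarrow> \<exists>c l. l < 1 \<and> {x, y} \<subseteq> {c..c + l} \<and> {c..c + l} \<subseteq> S"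
    and long: "\<And>l. 0 \<le> l \<Longrightarrow> l < 1 \<Longrightarrow> \<exists>c. {c..c + l} \<subseteq> S"
  obtains a where "{a<..<a + 1} \<subseteq> S"
proof
  define a where "a = Inf S"
  obtain c0 where "{c0..c0 + 0} \<subseteq> S" using long[of 0] by auto
  then have c0: "c0 \<in> S" by auto
  have close: "x - y < 1" if "x \<in> S" "y \<in> S" for x y
    using pairs[OF that] by fastforce
  have "bdd_below S"
    by (rule bdd_belowI[of _ "c0 - 1"]) (use close[OF c0] in force)
  show "{a<..<a + 1} \<subseteq> S"
  proof
    fix x assume x: "x \<in> {a<..<a + 1}"
    then obtain y where y: "y \<in> S" "y < x"
      using cInf_lessD[of S x] c0 by (auto simp: a_def)
    define l where "l = max 0 (x - a)"
    have "0 \<le> l" "l < 1" using x by (auto simp: l_def)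
    then obtain c where c: "{c..c + l} \<subseteq> S" using long by blast
    have "c \<in> S" "c + l \<in> S" using c \<open>0 \<le> l\<close> by auto
    then have "a \<le> c" unfolding a_def using \<open>bdd_below S\<close> by (auto intro: cInf_lower)
    then have "x \<le> c + l" using x by (auto simp: l_def)
    obtain d m where d: "{y, c + l} \<subseteq> {d..d + m}" "{d..d + m} \<subseteq> S"
      using pairs[OF y(1) \<open>c + l \<in> S\<close>] by blast
    then have "x \<in> {d..d + m}" using y(2) \<open>x \<le> c + l\<close> by auto
    then show "x \<in> S" using d(2) by blast
  qed
qed

lemma minimal_universal_isometric_open_unit_interval:
  assumes min: "minimal_universal_for short_closed_intervals X"
  shows "isometric X open_unit_interval"
proof -
  obtain h :: "_ \<Rightarrow> real" where h: "isometric_embedding h X euclidean_metric"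
    using minimal_universal_embeds_in_line[OF min] by (auto simp: embeds_isometrically_def)
  let ?S = "h ` mspace X"
  have sub: "\<exists>c. (h \<circ> f) ` {0..l} = {c..c + l} \<and> {c..c + l} \<subseteq> ?S"
    if f: "isometric_embedding f (segment l) X" and "0 \<le> l" for f l
  proof -
    obtain c where c: "(h \<circ> f) ` {0..l} = {c..c + l}"
      using segment_image_in_line[OF isometric_embedding_compose[OF f h] \<open>0 \<le> l\<close>] .
    moreover have "(h \<circ> f) ` {0..l} \<subseteq> ?S"
      using f by (auto simp: isometric_embedding_segment_iff)
    ultimately show ?thesis by auto
  qed
  obtain a where a: "{a<..<a + 1} \<subseteq> ?S"
  proof (rule contains_open_unit_interval[of ?S])
    fix u v assume "u \<in> ?S" "v \<in> ?S"
    then obtain x y where xy: "x \<in> mspace X" "y \<in> mspace X" "u = h x" "v = h y" by auto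
    obtain l f where f: "0 \<le> l" "l < 1" "isometric_embedding f (segment l) X" "{x, y} \<subseteq> f ` {0..l}"
      using minimal_universal_finite_subset_in_segment[OF min, of "{x, y}"] xy by auto
    then have "{u, v} \<subseteq> (h \<circ> f) ` {0..l}" using xy by auto
    then show "\<exists>c l. l < 1 \<and> {u, v} \<subseteq> {c..c + l} \<and> {c..c + l} \<subseteq> ?S"
      using sub[OF f(3,1)] f(2) by metis
  next
    fix l :: real assume "0 \<le> l" "l < 1"
    then obtain f where "isometric_embedding f (segment l) X"
      using min unfolding minimal_universal_for_def universal_iff_segments_embed
        embeds_isometrically_def by blast
    then show "\<exists>c. {c..c + l} \<subseteq> ?S" using sub \<open>0 \<le> l\<close> by blast
  qed
  define Y0 where "Y0 = {x \<in> mspace X. h x \<in> {a<..<a + 1}}"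
  have "Y0 \<subseteq> mspace X" by (auto simp: Y0_def)
  have hY0: "h ` Y0 = {a<..<a + 1}" using a by (auto simp: Y0_def)
  have "universal_for short_closed_intervals (submetric X Y0)"
    using unit_open_interval_universal[OF \<open>Y0 \<subseteq> mspace X\<close> h] hY0 by blast
  then have "Y0 = mspace X"
    using min \<open>Y0 \<subseteq> mspace X\<close> unfolding minimal_universal_for_def by blast
  then have hX: "?S = {a<..<a + 1}" using hY0 by simp
  have "(\<lambda>t. t - a) ` {a<..<a + 1} = {0<..<1}"
  proof
    show "{0<..<1} \<subseteq> (\<lambda>t. t - a) ` {a<..<a + 1}"
    proof
      fix u :: real assume "u \<in> {0<..<1}"
      then show "u \<in> (\<lambda>t. t - a) ` {a<..<a + 1}"
        by (intro image_eqI[of _ _ "u + a"]) auto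
    qed
  qed auto
  then have im: "(\<lambda>x. h x - a) ` mspace X = {0<..<1}"
    unfolding hX[symmetric] image_image .
  then have "isometric_embedding (\<lambda>x. h x - a) X open_unit_interval"
    using h by (simp add: isometric_embedding_def open_unit_interval_def dist_real_def)
  then show ?thesis using im unfolding isometric_def open_unit_interval_def by auto
qed

theorem proposition7p16:
  shows "minimal_universal_for short_closed_intervals open_unit_interval \<and>
    (\<forall>X :: 'a metric.
       minimal_universal_for short_closed_intervals X \<longrightarrow> isometric X open_unit_interval)"
  using minimal_universal_open_unit_interval minimal_universal_isometric_open_unit_interval by blast

end
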